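(* Let $N\cong\mathbb{Z}^3$, let $P\subset N_{\mathbb{R}}$ be an empty three-dimensional lattice polytope, and let $\mathcal S(P)$ be the set of square facets of $P$. Suppose that $$\sum_{F\in\mathcal S(P)}n_F\,(R^*-s_F)=R^*$$ for some $n_F\in\mathbb{N}=\{0,1,2,\dots\}$. Then there exist precisely two square facets $F_1,F_2\in\mathcal S(P)$ such that $n_{F_1}=n_{F_2}=1$, while $n_F=0$ for every $F\notin\{F_1,F_2\}$. Moreover, $F_1$ and $F_2$ are parallel.
   Context: Let $M=\operatorname{Hom}_{\mathbb{Z}}(N,\mathbb{Z})$, $\widetilde N=N\oplus\mathbb{Z}$, $\widetilde M=M\oplus\mathbb{Z}$. A lattice polytope $P\subset N_{\mathbb{R}}$ is empty if $P\cap N=\operatorname{Vert}(P)$. Let $\sigma\subset\widetilde N_{\mathbb{R}}$ be the cone generated by $P\times\{1\}$ and $\sigma^\vee\subset\widetilde M_{\mathbb{R}}$ its dual. Put $R^*=(0,1)\in\widetilde M$. For a facet $F\subset P$, $s_F\in\widetilde M$ is the primitive generator of the ray of $\sigma^\vee$ corresponding to $F$, i.e. the primitive element of $\widetilde M$ nonnegative on $\sigma$ with $\langle s_F,(v,1)\rangle=0$ for every $v\in F$. A square facet is a facet that is lattice equivalent (by an affine lattice isomorphism of the lattices in the affine spans) to the unit square $\operatorname{conv}\{(0,0),(1,0),(0,1),(1,1)\}$. Two facets are parallel if their affine spans are parallel planes. *)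

theory Defs
  imports "HOL-Analysis.Analysis"
begin

text \<open>
  A basis of the rank-three lattice is fixed: \<open>N = \<int>\<^sup>3\<close> inside \<open>N\<^sub>\<real> = real ^ 3\<close>.
  Linear functionals are represented by vectors through the inner product, so that
  \<open>Hom(N, \<int>)\<close> is the dual lattice of \<open>N\<close>, and the pairing of \<open>N\<^sub>\<real> \<oplus> \<real>\<close> with \<open>M\<^sub>\<real> \<oplus> \<real>\<close> is
  the inner product of \<open>(real ^ 3) \<times> real\<close>.
\<close>

definition int_lattice :: "(real ^ 'n) set" where
  "int_lattice = {x. \<forall>i. x $ i \<in> \<int>}"

definition dual_lattice :: "'a::real_inner set \<Rightarrow> 'a set" where
  "dual_lattice L = {m. \<forall>x\<in>L. m \<bullet> x \<in> \<int>}"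

definition M_tilde :: "((real ^ 3) \<times> real) set" where
  "M_tilde = dual_lattice int_lattice \<times> \<int>"

definition R_star :: "(real ^ 3) \<times> real" where
  "R_star = (0, 1)"

definition lattice_polytope :: "(real ^ 'n) set \<Rightarrow> bool" where
  "lattice_polytope P \<longleftrightarrow> (\<exists>V. finite V \<and> V \<subseteq> int_lattice \<and> P = convex hull V)"

definition empty_lattice_polytope :: "(real ^ 'n) set \<Rightarrow> bool" where
  "empty_lattice_polytope P \<longleftrightarrow>
     lattice_polytope P \<and> P \<inter> int_lattice = {v. v extreme_point_of P}"

definition cone_over :: "(real ^ 3) set \<Rightarrow> ((real ^ 3) \<times> real) set" where
  "cone_over P = convex_cone hull (P \<times> {1})"

definition dual_cone :: "'a::real_inner set \<Rightarrow> 'a set" where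
  "dual_cone C = {m. \<forall>x\<in>C. m \<bullet> x \<ge> 0}"

definition primitive_in :: "'a::real_vector set \<Rightarrow> 'a \<Rightarrow> bool" where
  "primitive_in L m \<longleftrightarrow>
     m \<in> L \<and> m \<noteq> 0 \<and> (\<forall>k::nat. \<forall>m'\<in>L. m = real k *\<^sub>R m' \<longrightarrow> k = 1)"

text \<open>Meaningful for \<open>P\<close> a three-dimensional lattice polytope and \<open>F\<close> a facet of \<open>P\<close>;
  then exactly one element satisfies the description.\<close>

definition facet_generator :: "(real ^ 3) set \<Rightarrow> (real ^ 3) set \<Rightarrow> (real ^ 3) \<times> real" where
  "facet_generator P F =
     (THE s. primitive_in M_tilde s \<and> s \<in> dual_cone (cone_over P) \<and> (\<forall>v\<in>F. s \<bullet> (v, 1) = 0))"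

text \<open>Every affine isomorphism between affine spans extends to an affine map of the ambient
  spaces, so it suffices to let \<open>f\<close> range over the latter.\<close>

definition lattice_equivalent :: "(real ^ 'm) set \<Rightarrow> (real ^ 'n) set \<Rightarrow> bool" where
  "lattice_equivalent A B \<longleftrightarrow>
     (\<exists>l c. let f = (\<lambda>x. l x + c) in
        linear l \<and>
        bij_betw f (affine hull A) (affine hull B) \<and>
        f ` (affine hull A \<inter> int_lattice) = affine hull B \<inter> int_lattice \<and>
        f ` A = B)"

definition unit_square :: "(real ^ 2) set" where
  "unit_square = convex hull {vector [0, 0], vector [1, 0], vector [0, 1], vector [1, 1]}"

definition square_facets :: "(real ^ 3) set \<Rightarrow> (real ^ 3) set set" where
  "square_facets P = {F. F facet_of P \<and> lattice_equivalent F unit_square}"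

end

theory Submission
  imports Defs
begin

text \<open>
  Write \<open>g\<^sub>F x = \<langle>s\<^sub>F, (x, 1)\<rangle>\<close> for the lattice distance from a facet. The hypothesis says that
  \<open>\<Sum> n\<^sub>F (1 - g\<^sub>F x) = 1\<close> for every point \<open>x\<close>. By emptiness, vertices of \<open>P\<close> are pairwise
  incongruent modulo 2, and the corners of a square facet \<open>F\<close> exhaust the classes in its plane; hence
  \<open>g\<^sub>F\<close> is odd at all vertices off \<open>F\<close>, and two square facets are disjoint or share an edge.
  In the latter case emptiness forces each to have distance 1 from the opposite edge of the other,
  so that \<open>g\<^sub>G = 1/2\<close> at the centre of \<open>F\<close>.

  Evaluate the identity at the centre of some \<open>F\<^sub>0\<close> with \<open>n\<^sub>F\<^sub>0 > 0\<close>. If all facets with positive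
  coefficient share edges with \<open>F\<^sub>0\<close>, only \<open>F\<^sub>0\<close> can remain, which is absurd. So there are disjoint
  \<open>F\<^sub>0\<close>, \<open>F\<^sub>1\<close>; together they contain a vertex of every class modulo 2, so any further square facet
  meets both, and then \<open>g\<^sub>F\<^sub>1 = 1\<close> on \<open>F\<^sub>0\<close>, which again overshoots the value 1. Hence only
  \<open>F\<^sub>0\<close> and \<open>F\<^sub>1\<close> remain, and primitivity of the facet generators gives both coefficients.
\<close>

section \<open>Lattice arithmetic, heights as affine functions, and emptiness\<close>

lemma int_lattice_add: "x \<in> int_lattice \<Longrightarrow> y \<in> int_lattice \<Longrightarrow> x + y \<in> int_lattice"
  by (simp add: int_lattice_def)

lemma int_lattice_diff: "x \<in> int_lattice \<Longrightarrow> y \<in> int_lattice \<Longrightarrow> x - y \<in> int_lattice"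
  by (simp add: int_lattice_def)

lemma int_lattice_minus: "x \<in> int_lattice \<Longrightarrow> - x \<in> int_lattice"
  by (simp add: int_lattice_def)

lemma int_lattice_scale: "x \<in> int_lattice \<Longrightarrow> of_int k *\<^sub>R x \<in> int_lattice"
  by (simp add: int_lattice_def)

lemmas int_lattice_intros = int_lattice_add int_lattice_diff int_lattice_minus int_lattice_scale

lemma dual_int_lattice: "dual_lattice int_lattice = (int_lattice :: (real ^ 'n) set)"
proof (intro equalityI subsetI)
  fix m :: "real ^ 'n"
  assume "m \<in> dual_lattice int_lattice"
  moreover have "axis i (1::real) \<in> int_lattice" for i :: 'n
    by (simp add: int_lattice_def axis_def)
  ultimately have "m \<bullet> axis i (1::real) \<in> \<int>" for i
    by (simp add: dual_lattice_def)
  then show "m \<in> int_lattice"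
    by (simp add: int_lattice_def inner_axis)
next
  fix m :: "real ^ 'n"
  assume "m \<in> int_lattice"
  then show "m \<in> dual_lattice int_lattice"
    by (auto simp: dual_lattice_def int_lattice_def inner_vec_def intro!: Ints_sum Ints_mult)
qed

text \<open>On the slice \<open>(x, 1)\<close> a functional becomes an affine function with linear
  part \<open>fst s\<close>; for a facet generator it is the lattice distance from the
  facet.\<close>

definition ev :: "(real ^ 3) \<times> real \<Rightarrow> real ^ 3 \<Rightarrow> real" where
  "ev s x = s \<bullet> (x, 1)"

lemma ev_alt: "ev s x = fst s \<bullet> x + snd s"
  by (cases s) (simp add: ev_def inner_Pair)

lemma ev_add: "ev s (x + y) = ev s x + fst s \<bullet> y"
  by (simp add: ev_alt inner_add_right)

lemma ev_diff: "ev s (x - y) = ev s x - fst s \<bullet> y"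
  by (simp add: ev_alt inner_diff_right)

lemma ev_diff_ev: "fst s \<bullet> (x - y) = ev s x - ev s y"
  by (simp add: ev_alt inner_diff_right)

lemma fst_M_tilde_int: "s \<in> M_tilde \<Longrightarrow> x \<in> int_lattice \<Longrightarrow> fst s \<bullet> x \<in> \<int>"
  by (auto simp: M_tilde_def dual_lattice_def)

lemma ev_int: "s \<in> M_tilde \<Longrightarrow> x \<in> int_lattice \<Longrightarrow> ev s x \<in> \<int>"
  using fst_M_tilde_int[of s x] by (auto simp: ev_alt M_tilde_def)

lemma convex_shift:
  assumes "convex P" "x \<in> P" "x + v \<in> P" "0 \<le> t" "t \<le> 1"
  shows "x + t *\<^sub>R v \<in> P"
proof -
  have "(1 - t) *\<^sub>R x + t *\<^sub>R (x + v) \<in> P"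
    using assms by (intro convexD_alt) auto
  then show ?thesis by (simp add: algebra_simps)
qed

lemma empty_lattice_polytope_convex: "empty_lattice_polytope P \<Longrightarrow> convex P"
  by (auto simp: empty_lattice_polytope_def lattice_polytope_def)

text \<open>A lattice point of an empty polytope is a vertex, so it cannot lie strictly inside a
  segment of \<open>P\<close>. The condition on lattice points enters only here: later arguments
  exhibit a lattice point between two points of \<open>P\<close>.\<close>

lemma empty_lattice_polytope_segment:
  assumes "empty_lattice_polytope P" "x \<in> P" "z \<in> P" "0 < t" "t < 1"
    and "x + t *\<^sub>R (z - x) \<in> int_lattice"
  shows "x = z"
proof (rule ccontr)
  assume "x \<noteq> z"
  let ?y = "x + t *\<^sub>R (z - x)"
  have y: "?y = (1 - t) *\<^sub>R x + t *\<^sub>R z" by (simp add: algebra_simps)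
  have "?y \<in> P"
    unfolding y using empty_lattice_polytope_convex[OF assms(1)] assms by (intro convexD_alt) auto
  then have "?y extreme_point_of P"
    using assms by (auto simp: empty_lattice_polytope_def)
  moreover have "?y \<in> open_segment x z"
    unfolding in_segment using y \<open>x \<noteq> z\<close> assms by blast
  ultimately show False
    using assms by (auto simp: extreme_point_of_def)
qed

subsection \<open>Squares on the boundary of an empty polytope\<close>

text \<open>A square facet in coordinates: corner \<open>a\<close>, edge vectors \<open>p\<close>
  and \<open>q\<close>, supporting functional \<open>s\<close>. This form lets the corner and the
  edges be relabelled freely. The last clause encodes primitivity of \<open>s\<close> by a lattice
  point at height 1.\<close>

definition square_at :: "(real ^ 3) set \<Rightarrow> (real ^ 3) \<times> real \<Rightarrow> real ^ 3 \<Rightarrow> real ^ 3 \<Rightarrow> real ^ 3 \<Rightarrow> bool" where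
  "square_at P s a p q \<longleftrightarrow>
     s \<in> M_tilde \<and> a \<in> int_lattice \<and> p \<in> int_lattice \<and> q \<in> int_lattice \<and> p \<noteq> 0 \<and> q \<noteq> 0 \<and>
     a \<in> P \<and> a + p \<in> P \<and> a + q \<in> P \<and> a + p + q \<in> P \<and>
     (\<forall>x\<in>P. 0 \<le> ev s x) \<and> ev s a = 0 \<and> fst s \<bullet> p = 0 \<and> fst s \<bullet> q = 0 \<and>
     (\<forall>x\<in>int_lattice. ev s x = 0 \<longrightarrow> (\<exists>i j::int. x = a + of_int i *\<^sub>R p + of_int j *\<^sub>R q)) \<and>
     (\<forall>x. ev s x = 0 \<longrightarrow> (\<exists>i j. x = a + i *\<^sub>R p + j *\<^sub>R q)) \<and>
     (\<exists>y\<in>int_lattice. ev s y = 1)"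

lemma square_at_swap:
  assumes "square_at P s a p q" shows "square_at P s a q p"
proof -
  have "a + i *\<^sub>R p + j *\<^sub>R q = a + j *\<^sub>R q + i *\<^sub>R p" for i j by simp
  then have
    "\<forall>x\<in>int_lattice. ev s x = 0 \<longrightarrow> (\<exists>i j::int. x = a + of_int i *\<^sub>R q + of_int j *\<^sub>R p)"
    "\<forall>x. ev s x = 0 \<longrightarrow> (\<exists>i j. x = a + i *\<^sub>R q + j *\<^sub>R p)"
    using assms unfolding square_at_def by metis+
  then show ?thesis
    using assms unfolding square_at_def by (simp add: add_ac)
qed

text \<open>Together with \<open>square_at_swap\<close> this generates all eight symmetries of the
  square.\<close>

lemma square_at_flip:
  assumes "square_at P s a p q" shows "square_at P s (a + p) (- p) q"
proof -
  have "\<exists>i' j'::int. x = a + p + of_int i' *\<^sub>R (- p) + of_int j' *\<^sub>R q"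
    if "x = a + of_int i *\<^sub>R p + of_int j *\<^sub>R q" for x and i j :: int
    using that by (intro exI[of _ "1 - i"] exI[of _ j]) (simp add: algebra_simps)
  moreover have "\<exists>i' j'. x = a + p + i' *\<^sub>R (- p) + j' *\<^sub>R q"
    if "x = a + i *\<^sub>R p + j *\<^sub>R q" for x i j
    using that by (intro exI[of _ "1 - i"] exI[of _ j]) (simp add: algebra_simps)
  ultimately have
    "\<forall>x\<in>int_lattice. ev s x = 0 \<longrightarrow> (\<exists>i j::int. x = a + p + of_int i *\<^sub>R (- p) + of_int j *\<^sub>R q)"
    "\<forall>x. ev s x = 0 \<longrightarrow> (\<exists>i j. x = a + p + i *\<^sub>R (- p) + j *\<^sub>R q)"
    using assms unfolding square_at_def by meson+
  then show ?thesis
    using assms unfolding square_at_def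
    by (simp add: ev_add int_lattice_add int_lattice_minus)
qed

text \<open>The corners of a square represent all classes modulo 2 in its plane, so a lattice point at
  even height is congruent to a corner; the midpoint of the two is a lattice point of \<open>P\<close>.\<close>

lemma square_at_even:
  assumes E: "empty_lattice_polytope P" and S: "square_at P s a p q"
    and x: "x \<in> P" "x \<in> int_lattice" "ev s x = 2 * of_int m"
  shows "x \<in> {a, a + p, a + q, a + p + q}"
proof -
  obtain y where y: "y \<in> int_lattice" "ev s y = 1" using S by (auto simp: square_at_def)
  have lat: "a \<in> int_lattice" "p \<in> int_lattice" "q \<in> int_lattice" and a0: "ev s a = 0"
    using S by (auto simp: square_at_def)
  \<comment> \<open>Since \<open>y - a\<close> has height 1, this moves \<open>x\<close> into the
    plane of the square; the even multiplier preserves the class modulo 2.\<close>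
  define z where "z = x - of_int (2 * m) *\<^sub>R (y - a)"
  have "z \<in> int_lattice" unfolding z_def using x y lat by (intro int_lattice_intros)
  moreover have "ev s z = 0"
    using x y a0 by (simp add: z_def ev_diff ev_diff_ev)
  ultimately obtain i j :: int where ij: "z = a + of_int i *\<^sub>R p + of_int j *\<^sub>R q"
    using S by (auto simp: square_at_def)
  \<comment> \<open>The corner congruent to \<open>z\<close>, and hence to \<open>x\<close>, modulo
    2.\<close>
  define c where "c = a + of_int (i mod 2) *\<^sub>R p + of_int (j mod 2) *\<^sub>R q"
  have "i mod 2 = 0 \<or> i mod 2 = 1" "j mod 2 = 0 \<or> j mod 2 = 1" by auto
  then have c: "c \<in> {a, a + p, a + q, a + p + q}"
    unfolding c_def by auto
  then have "c \<in> P" using S by (auto simp: square_at_def)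
  have xx: "x = c + 2 *\<^sub>R (of_int m *\<^sub>R (y - a) + of_int (i div 2) *\<^sub>R p + of_int (j div 2) *\<^sub>R q)"
  proof -
    have i: "of_int i = 2 * of_int (i div 2) + (of_int (i mod 2) :: real)"
      by (metis mult_div_mod_eq of_int_add of_int_mult of_int_numeral)
    have j: "of_int j = 2 * of_int (j div 2) + (of_int (j mod 2) :: real)"
      by (metis mult_div_mod_eq of_int_add of_int_mult of_int_numeral)
    have "x = z + of_int (2 * m) *\<^sub>R (y - a)" by (simp add: z_def)
    then show ?thesis unfolding ij c_def i j by (simp add: algebra_simps)
  qed
  have "c \<in> int_lattice" unfolding c_def using lat by (intro int_lattice_intros)
  then have "c + (of_int m *\<^sub>R (y - a) + of_int (i div 2) *\<^sub>R p + of_int (j div 2) *\<^sub>R q) \<in> int_lattice"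
    using y lat by (intro int_lattice_intros)
  then have "c + (1/2) *\<^sub>R (x - c) \<in> int_lattice" by (subst xx) simp
  then have "c = x"
    using empty_lattice_polytope_segment[OF E \<open>c \<in> P\<close> x(1), of "1/2"] by simp
  then show ?thesis using c by simp
qed

lemma square_at_height:
  assumes S: "square_at P s a p q" and x: "x \<in> P" "x \<in> int_lattice"
  obtains k :: nat where "ev s x = real k"
proof -
  have "ev s x \<in> \<int>" "0 \<le> ev s x" using S x by (auto simp: square_at_def ev_int)
  then have "ev s x \<in> \<nat>" using Nats_altdef2 by blast
  then show ?thesis using that by (auto elim: Nats_cases)
qed

text \<open>An even height would make \<open>x\<close> a corner, and corners have height 0.\<close>

lemma square_at_odd:
  assumes E: "empty_lattice_polytope P" and S: "square_at P s a p q"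
    and x: "x \<in> P" "x \<in> int_lattice" "ev s x \<noteq> 0"
  obtains k :: nat where "ev s x = real k" "odd k"
proof -
  obtain k where k: "ev s x = real k" using square_at_height[OF S x(1,2)] .
  have "odd k"
  proof
    assume "even k"
    then obtain m where "k = 2 * m" by blast
    then have "x \<in> {a, a + p, a + q, a + p + q}"
      using square_at_even[OF E S x(1,2), of "int m"] k by simp
    then have "ev s x = 0" using S by (auto simp: square_at_def ev_add)
    then show False using x by simp
  qed
  then show ?thesis using that k by blast
qed

text \<open>If the height \<open>t\<close> of the far edge were at least 2, a lattice point at height 1, reduced modulo
  the lattice of the other square, would lie in the triangular prism spanned by the two squares.\<close>

lemma square_at_common_edge:
  assumes E: "empty_lattice_polytope P" and S: "square_at P s a e p" and S': "square_at P s' a e q"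
    and pos: "ev s' (a + p) \<noteq> 0"
  shows "ev s' (a + p) = 1"
proof (rule ccontr)
  assume n1: "ev s' (a + p) \<noteq> 1"
  have lat: "a \<in> int_lattice" "e \<in> int_lattice" "p \<in> int_lattice" "q \<in> int_lattice"
    using S S' by (auto simp: square_at_def)
  have inP: "a \<in> P" "a + e \<in> P" "a + p \<in> P" "a + p + e \<in> P" "a + q \<in> P" "a + q + e \<in> P"
    using S S' by (auto simp: square_at_def add_ac)
  have z: "ev s' a = 0" "fst s' \<bullet> e = 0" "fst s' \<bullet> q = 0" using S' by (auto simp: square_at_def)
  obtain t :: nat where t: "ev s' (a + p) = real t"
    using square_at_height[OF S', of "a + p"] inP lat int_lattice_add by blast
  have t2: "t \<ge> 2" using n1 pos t by (cases t rule: nat.exhaust) (auto simp: Suc_le_eq intro: ccontr)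
  obtain y where y: "y \<in> int_lattice" "ev s' y = 1" using S' by (auto simp: square_at_def)
  \<comment> \<open>Both \<open>t (y - a)\<close> and \<open>p\<close> raise \<open>ev s'\<close> by
    \<open>t\<close>, so this lattice point lies in the plane of the second square.\<close>
  let ?x = "a + of_int (int t) *\<^sub>R (y - a) - p"
  have "?x \<in> int_lattice" using y lat by (intro int_lattice_intros)
  moreover have "ev s' ?x = 0"
    using t y z by (simp add: ev_diff ev_add ev_diff_ev)
  ultimately obtain i j :: int where ij: "?x = a + of_int i *\<^sub>R e + of_int j *\<^sub>R q"
    using S' unfolding square_at_def by blast
  \<comment> \<open>Translating \<open>y\<close> by the lattice of the second square reduces the
    coefficients modulo \<open>t\<close>; the result \<open>w\<close> keeps height 1 over that
    square.\<close>
  define i' j' where "i' = i mod int t" and "j' = j mod int t"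
  define w where "w = y - of_int (i div int t) *\<^sub>R e - of_int (j div int t) *\<^sub>R q"
  have w: "w \<in> int_lattice" unfolding w_def using y lat by (intro int_lattice_intros)
  have i'r: "0 \<le> i'" "i' < int t" and j'r: "0 \<le> j'" "j' < int t"
    using t2 by (auto simp: i'_def j'_def)
  have i: "of_int i = real t * of_int (i div int t) + (of_int i' :: real)"
    unfolding i'_def by (metis mult_div_mod_eq of_int_add of_int_mult of_int_of_nat_eq)
  have j: "of_int j = real t * of_int (j div int t) + (of_int j' :: real)"
    unfolding j'_def by (metis mult_div_mod_eq of_int_add of_int_mult of_int_of_nat_eq)
  have "real t *\<^sub>R (y - a) = p + of_int i *\<^sub>R e + of_int j *\<^sub>R q"
    using ij by (simp add: algebra_simps)
  then have "real t *\<^sub>R (w - a) = p + of_int i' *\<^sub>R e + of_int j' *\<^sub>R q"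
    unfolding w_def i j by (simp add: algebra_simps)
  then have "(1 / real t) *\<^sub>R (real t *\<^sub>R (w - a)) = (1 / real t) *\<^sub>R (p + of_int i' *\<^sub>R e + of_int j' *\<^sub>R q)"
    by simp
  then have wa: "w = a + (1 / t) *\<^sub>R p + (i' / t) *\<^sub>R e + (j' / t) *\<^sub>R q"
    using t2 by (simp add: algebra_simps)
  have C: "convex P" using E by (rule empty_lattice_polytope_convex)
  \<comment> \<open>The segment from \<open>a + \<alpha> e + \<beta> q\<close> in the second square
    to \<open>a + p + \<alpha> e\<close> on the far edge of the first passes through
    \<open>w\<close> at parameter \<open>1/t\<close>. This scales the \<open>q\<close>-coordinate by
    \<open>1 - 1/t\<close>, whence the denominator \<open>t - 1\<close>; the bound
    \<open>j' \<le> t - 1\<close> keeps \<beta> at most 1.\<close>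
  define \<alpha> \<beta> where "\<alpha> = i' / t" and "\<beta> = j' / (real t - 1)"
  have \<alpha>: "0 \<le> \<alpha>" "\<alpha> \<le> 1" using i'r t2 by (auto simp: \<alpha>_def)
  have \<beta>: "0 \<le> \<beta>" "\<beta> \<le> 1" using j'r t2 by (auto simp: \<beta>_def)
  have 1: "a + p + \<alpha> *\<^sub>R e \<in> P" using convex_shift[OF C _ _ \<alpha>] inP by blast
  have "a + \<alpha> *\<^sub>R e \<in> P" "a + q + \<alpha> *\<^sub>R e \<in> P" using convex_shift[OF C _ _ \<alpha>] inP by blast+
  then have 2: "a + \<alpha> *\<^sub>R e + \<beta> *\<^sub>R q \<in> P" 
    using convex_shift[OF C _ _ \<beta>, of "a + \<alpha> *\<^sub>R e" q] by (simp add: add_ac)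
  have "(1 - 1/t) * \<beta> = j' / t" using t2 by (simp add: \<beta>_def field_simps)
  then have "\<beta> = j' / t + (1/t) * \<beta>" by (simp add: algebra_simps)
  then have "a + \<alpha> *\<^sub>R e + \<beta> *\<^sub>R q + (1/t) *\<^sub>R ((a + p + \<alpha> *\<^sub>R e) - (a + \<alpha> *\<^sub>R e + \<beta> *\<^sub>R q))
     = a + \<alpha> *\<^sub>R e + (j' / t + (1/t) * \<beta>) *\<^sub>R q + (1/t) *\<^sub>R ((a + p + \<alpha> *\<^sub>R e) - (a + \<alpha> *\<^sub>R e + \<beta> *\<^sub>R q))"
    by simp
  also have "\<dots> = w" unfolding wa \<alpha>_def by (simp add: algebra_simps)
  finally have "a + \<alpha> *\<^sub>R e + \<beta> *\<^sub>R q + (1/t) *\<^sub>R ((a + p + \<alpha> *\<^sub>R e) - (a + \<alpha> *\<^sub>R e + \<beta> *\<^sub>R q)) \<in> int_lattice"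
    using w by (simp only:)
  moreover have "0 < 1 / real t" "1 / real t < 1" using t2 by auto
  ultimately have "a + \<alpha> *\<^sub>R e + \<beta> *\<^sub>R q = a + p + \<alpha> *\<^sub>R e"
    using empty_lattice_polytope_segment[OF E 2 1] by blast
  then have "ev s' (a + \<alpha> *\<^sub>R e + \<beta> *\<^sub>R q) = ev s' (a + p + \<alpha> *\<^sub>R e)" by (simp only:)
  then show False using z t pos by (simp add: ev_add)
qed

section \<open>Two square facets with a common lattice point\<close>

text \<open>Used to align two squares found to share an edge: the two labellings of that edge agree
  up to direction.\<close>

lemma edge_orientation:
  fixes v :: "'a :: ab_group_add"
  assumes "w \<in> {v, v + e}" "w + f \<in> {v, v + e}" "f \<noteq> 0"
  obtains "w = v" "f = e" | "w = v + e" "f = - e"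
proof -
  have "f = - e" if "v + e + f = v"
    using that by (simp add: add.assoc minus_unique)
  then show ?thesis using assms that by auto
qed

lemma square_at_corner:
  assumes E: "empty_lattice_polytope P" and S: "square_at P s a p q"
    and x: "x \<in> P" "x \<in> int_lattice" "ev s x = 0"
  shows "x \<in> {a, a + p, a + q, a + p + q}"
  using square_at_even[OF E S x(1,2), of 0] x(3) by simp

text \<open>The symmetries move any corner to the base. The centre is tracked because the identity
  between generators is later evaluated there.\<close>

lemma square_at_rebase:
  assumes S: "square_at P s a p q" and v: "v \<in> {a, a + p, a + q, a + p + q}"
  obtains p' q' where "square_at P s v p' q'"
    "v + (1/2) *\<^sub>R (p' + q') = a + (1/2) *\<^sub>R (p + q)"
proof -
  note S1 = square_at_flip[OF S]
  note S2 = square_at_swap[OF square_at_flip[OF square_at_swap[OF S]]]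
  note S3 = square_at_swap[OF square_at_flip[OF square_at_swap[OF S1]]]
  have half: "(1/2) *\<^sub>R x + (1/2) *\<^sub>R x = x" for x :: "real ^ 3"
    by (simp add: scaleR_left_distrib[symmetric])
  have c: "a + p + (1/2) *\<^sub>R (- p + q) = a + (1/2) *\<^sub>R (p + q)"
    "a + q + (1/2) *\<^sub>R (p + - q) = a + (1/2) *\<^sub>R (p + q)"
    "a + p + q + (1/2) *\<^sub>R (- p + - q) = a + (1/2) *\<^sub>R (p + q)"
    using half[of p] half[of q] by (simp_all add: algebra_simps)
  show ?thesis
    using v that[of p q] that[of "- p" q] that[of p "- q"] that[of "- p" "- q"] S S1 S2 S3 c
    by blast
qed

text \<open>If \<open>s'\<close> were positive at both neighbours of the common corner
  \<open>v\<close>, both heights would be odd, and the corner opposite to \<open>v\<close> would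
  have their sum as height, which is even and nonzero. So \<open>s'\<close> vanishes along an edge
  at \<open>v\<close>; the point \<open>z\<close> shows that it does not vanish on the whole
  square.\<close>

lemma square_at_edge:
  assumes E: "empty_lattice_polytope P" and S: "square_at P s a p q" and S': "square_at P s' a' p' q'"
    and v: "v \<in> P" "v \<in> int_lattice" "ev s v = 0" "ev s' v = 0"
    and neq: "ev s z = 0" "ev s' z \<noteq> 0"
  obtains A e b where "square_at P s A e b" "A + (1/2) *\<^sub>R (e + b) = a + (1/2) *\<^sub>R (p + q)"
    "ev s' A = 0" "ev s' (A + e) = 0" "ev s' (A + b) \<noteq> 0" "ev s' (A + e + b) \<noteq> 0"
proof -
  obtain p1 q1 where S1: "square_at P s v p1 q1"
    "v + (1/2) *\<^sub>R (p1 + q1) = a + (1/2) *\<^sub>R (p + q)"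
    using square_at_rebase[OF S square_at_corner[OF E S v(1-3)]] .
  have lat: "p1 \<in> int_lattice" "q1 \<in> int_lattice" "v + p1 \<in> P" "v + q1 \<in> P" "v + p1 + q1 \<in> P"
    using S1 by (auto simp: square_at_def)
  have cases: "ev s' (v + p1) = 0 \<or> ev s' (v + q1) = 0"
  proof (rule ccontr)
    assume "\<not> ?thesis"
    then have n: "ev s' (v + p1) \<noteq> 0" "ev s' (v + q1) \<noteq> 0" by auto
    obtain k l where k: "ev s' (v + p1) = real k" "odd k" and l: "ev s' (v + q1) = real l" "odd l"
      using square_at_odd[OF E S' _ _ n(1)] square_at_odd[OF E S' _ _ n(2)] lat v int_lattice_add
      by metis
    have kl: "ev s' (v + p1 + q1) = real (k + l)"
      using k l v by (simp add: ev_add)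
    moreover have "k + l \<noteq> 0" using k by (cases k) auto
    ultimately have "ev s' (v + p1 + q1) \<noteq> 0" by (simp only: of_nat_eq_0_iff not_False_eq_True)
    then obtain r where "ev s' (v + p1 + q1) = real r" and "odd r"
      using square_at_odd[OF E S'] lat v int_lattice_add by metis
    then have "k + l = r" using kl by (simp only: of_nat_eq_iff)
    then show False using \<open>odd r\<close> k(2) l(2) by (metis odd_even_add)
  qed
  obtain i j where z: "z = v + i *\<^sub>R p1 + j *\<^sub>R q1"
    using S1(1) neq(1) unfolding square_at_def by blast
  have "ev s' z = i * ev s' (v + p1) + j * ev s' (v + q1)"
    using v unfolding z by (simp add: ev_add)
  then have "ev s' (v + p1) \<noteq> 0 \<or> ev s' (v + q1) \<noteq> 0" using neq by auto
  then consider "ev s' (v + p1) = 0" "ev s' (v + q1) \<noteq> 0" | "ev s' (v + p1) \<noteq> 0" "ev s' (v + q1) = 0"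
    using cases by blast
  then show ?thesis
  proof cases
    case 1
    then show ?thesis using that[OF S1] v by (simp add: ev_add)
  next
    case 2
    have "ev s' (v + q1 + p1) \<noteq> 0" using 2 v by (simp add: ev_add)
    then show ?thesis
      using that[OF square_at_swap[OF S1(1)]] S1(2) 2 v(4) by (simp add: add.commute[of q1 p1])
  qed
qed

text \<open>Each square has an edge in the plane of the other. Corners of the first edge are corners
  of the second square lying in the plane of the first, so the edges coincide up to direction. Then
  \<open>square_at_common_edge\<close> applies both ways.\<close>

lemma square_at_adjacent:
  assumes E: "empty_lattice_polytope P" and S: "square_at P s a p q" and S': "square_at P s' a' p' q'"
    and v: "v \<in> P" "v \<in> int_lattice" "ev s v = 0" "ev s' v = 0"
    and neq: "ev s z = 0" "ev s' z \<noteq> 0" and neq': "ev s' z' = 0" "ev s z' \<noteq> 0"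
  obtains A e b c where "square_at P s A e b" "square_at P s' A e c"
    "ev s' (A + b) = 1" "ev s (A + c) = 1"
    "A + (1/2) *\<^sub>R (e + b) = a + (1/2) *\<^sub>R (p + q)"
    "A + (1/2) *\<^sub>R (e + c) = a' + (1/2) *\<^sub>R (p' + q')"
proof -
  obtain A e b where 1: "square_at P s A e b" "A + (1/2) *\<^sub>R (e + b) = a + (1/2) *\<^sub>R (p + q)"
    "ev s' A = 0" "ev s' (A + e) = 0" "ev s' (A + b) \<noteq> 0" "ev s' (A + e + b) \<noteq> 0"
    using square_at_edge[OF E S S' v neq] .
  obtain A' e' c where 2: "square_at P s' A' e' c" "A' + (1/2) *\<^sub>R (e' + c) = a' + (1/2) *\<^sub>R (p' + q')"
    "ev s A' = 0" "ev s (A' + e') = 0" "ev s (A' + c) \<noteq> 0" "ev s (A' + e' + c) \<noteq> 0"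
    using square_at_edge[OF E S' S v(1,2,4,3) neq'] .
  have c1: "A \<in> P" "A + e \<in> P" "A \<in> int_lattice" "A + e \<in> int_lattice" "ev s A = 0" "ev s (A + e) = 0" "e \<noteq> 0"
    using 1(1) by (auto simp: square_at_def int_lattice_add ev_add)
  have "A \<in> {A', A' + e'}" "A + e \<in> {A', A' + e'}"
    using square_at_corner[OF E 2(1), of A] square_at_corner[OF E 2(1), of "A + e"] c1 1 2 by auto
  then consider "A = A'" "e = e'" | "A = A' + e'" "e = - e'"
    using c1(7) edge_orientation by blast
  then have "square_at P s' A e c \<and> A + (1/2) *\<^sub>R (e + c) = a' + (1/2) *\<^sub>R (p' + q')
      \<and> ev s (A + c) \<noteq> 0"
  proof cases
    case 1
    then show ?thesis using 2 by simp
  next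
    case 2
    have "A' + e' + (1/2) *\<^sub>R (- e' + c) = A' + (1/2) *\<^sub>R (e' + c)"
      using scaleR_left_distrib[of "1/2" "1/2" e'] by (simp add: algebra_simps)
    then show ?thesis using 2 \<open>square_at P s' A' e' c\<close>
        \<open>A' + (1/2) *\<^sub>R (e' + c) = a' + (1/2) *\<^sub>R (p' + q')\<close> \<open>ev s (A' + e' + c) \<noteq> 0\<close>
      by (simp add: square_at_flip)
  qed
  then show ?thesis
    using that[of A e b c] 1 square_at_common_edge[OF E, of s A e b s' c] square_at_common_edge[OF E, of s' A e c s b]
    by blast
qed

text \<open>The centre is midway between the shared edge, at height 0, and the opposite edge, at
  height 1.\<close>

lemma square_at_centre_adjacent:
  assumes "empty_lattice_polytope P" "square_at P s a p q" "square_at P s' a' p' q'"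
    and "v \<in> P" "v \<in> int_lattice" "ev s v = 0" "ev s' v = 0"
    and "ev s z = 0" "ev s' z \<noteq> 0" "ev s' z' = 0" "ev s z' \<noteq> 0"
  shows "ev s' (a + (1/2) *\<^sub>R (p + q)) = 1/2"
proof -
  obtain A e b c where *: "square_at P s A e b" "square_at P s' A e c"
    "ev s' (A + b) = 1" "ev s (A + c) = 1"
    "A + (1/2) *\<^sub>R (e + b) = a + (1/2) *\<^sub>R (p + q)"
    using square_at_adjacent[OF assms] by metis
  then have "ev s' A = 0" "fst s' \<bullet> e = 0" by (auto simp: square_at_def)
  then have "ev s' (A + (1/2) *\<^sub>R (e + b)) = 1/2"
    using *(3) by (simp add: ev_add inner_add_right)
  then show ?thesis by (simp only: *(5))
qed

section \<open>Disjoint squares and a third square meeting both\<close>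

text \<open>All corners of the first square have odd height over the second, so
  \<open>fst s'\<close> is even on \<open>p\<close> and \<open>q\<close>. Both \<open>x\<close> and
  \<open>a'\<close> have odd height over the first square, so \<open>x - a'\<close> is a combination
  of \<open>p\<close>, \<open>q\<close> and an even multiple of a lattice vector. Hence
  \<open>ev s' x\<close> is even, and \<open>x\<close> is a corner of the second square.\<close>

lemma square_at_disjoint_cover:
  assumes E: "empty_lattice_polytope P" and S: "square_at P s a p q" and S': "square_at P s' a' p' q'"
    and disj: "\<And>x. x \<in> P \<Longrightarrow> x \<in> int_lattice \<Longrightarrow> ev s x = 0 \<Longrightarrow> ev s' x \<noteq> 0"
    and x: "x \<in> P" "x \<in> int_lattice" "ev s x \<noteq> 0"
  shows "ev s' x = 0"
proof -
  have lat: "a \<in> int_lattice" "p \<in> int_lattice" "q \<in> int_lattice" "a' \<in> int_lattice" "a' \<in> P"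
    "a \<in> P" "a + p \<in> P" "a + q \<in> P"
    "s' \<in> M_tilde" "ev s a = 0" "fst s \<bullet> p = 0" "fst s \<bullet> q = 0" "ev s' a' = 0"
    using S S' by (auto simp: square_at_def)
  have nz: "ev s' a \<noteq> 0" "ev s' (a + p) \<noteq> 0" "ev s' (a + q) \<noteq> 0" "ev s a' \<noteq> 0"
    using disj[of a] disj[of "a + p"] disj[of "a + q"] disj[of a'] lat
    by (auto simp: ev_add int_lattice_add)
  obtain k0 where k0: "ev s' a = real k0" "odd k0"
    using square_at_odd[OF E S' _ _ nz(1)] lat by blast
  obtain k1 where k1: "ev s' (a + p) = real k1" "odd k1"
    using square_at_odd[OF E S' _ _ nz(2)] lat int_lattice_add by blast
  obtain k2 where k2: "ev s' (a + q) = real k2" "odd k2"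
    using square_at_odd[OF E S' _ _ nz(3)] lat int_lattice_add by blast
  obtain k where k: "ev s x = real k" "odd k" using square_at_odd[OF E S x] .
  obtain l where l: "ev s a' = real l" "odd l" using square_at_odd[OF E S _ _ nz(4)] lat by blast
  have "even (int k1 - int k0)" "even (int k2 - int k0)" "even (int k - int l)"
    using k0 k1 k2 k l by auto
  then obtain d1 d2 m where d: "int k1 - int k0 = 2 * d1" "int k2 - int k0 = 2 * d2" "int k - int l = 2 * m"
    unfolding dvd_def by blast
  have dr: "real k1 - real k0 = 2 * of_int d1" "real k2 - real k0 = 2 * of_int d2"
    "real k - real l = 2 * of_int m"
    using d by linarith+
  have u: "fst s' \<bullet> p = 2 * of_int d1" "fst s' \<bullet> q = 2 * of_int d2"
    using k0(1) k1(1) k2(1) dr by (simp_all add: ev_add)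
  obtain y where y: "y \<in> int_lattice" "ev s y = 1" using S by (auto simp: square_at_def)
  \<comment> \<open>The heights of \<open>x\<close> and \<open>a'\<close> differ by
    \<open>k - l = 2 m\<close>, which the last term cancels.\<close>
  let ?z = "x - a' + a - of_int (2 * m) *\<^sub>R (y - a)"
  have "?z \<in> int_lattice" using x y lat by (intro int_lattice_intros)
  moreover have "ev s ?z = 0"
    using y lat k l dr by (simp add: ev_diff ev_add ev_diff_ev) (simp add: ev_alt)
  ultimately obtain i j :: int where ij: "?z = a + of_int i *\<^sub>R p + of_int j *\<^sub>R q"
    using S unfolding square_at_def by blast
  have "fst s' \<bullet> (y - a) \<in> \<int>" using y lat by (intro fst_M_tilde_int int_lattice_intros)
  then obtain r where r: "fst s' \<bullet> (y - a) = of_int r" by (auto elim: Ints_cases)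
  have "x = a' + of_int i *\<^sub>R p + of_int j *\<^sub>R q + of_int (2 * m) *\<^sub>R (y - a)"
    using ij by (simp add: algebra_simps)
  then have "ev s' x = ev s' (a' + of_int i *\<^sub>R p + of_int j *\<^sub>R q + of_int (2 * m) *\<^sub>R (y - a))"
    by (simp only:)
  also have "\<dots> = of_int i * (2 * of_int d1) + of_int j * (2 * of_int d2) + of_int (2 * m) * of_int r"
    using lat by (simp only: ev_add inner_scaleR_right u r add_0)
  also have "\<dots> = 2 * of_int (i * d1 + j * d2 + m * r)" by (simp add: algebra_simps)
  finally have "ev s' x = 2 * of_int (i * d1 + j * d2 + m * r)" .
  then have "x \<in> {a', a' + p', a' + q', a' + p' + q'}"
    using square_at_even[OF E S' x(1,2)] by blast
  then show ?thesis using S' by (auto simp: square_at_def ev_add)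
qed

text \<open>The edges of the two opposite squares that lie away from the third one span a parallelogram;
  if its height over the first square exceeded 1, it would contain a lattice point at height 1.\<close>

lemma square_at_opposite_edge:
  assumes E: "empty_lattice_polytope P"
    and S0: "square_at P s0 A e p" and S2: "square_at P s2 A e q" and S1: "square_at P s1 (A + q) e c"
    and h: "ev s2 (A + p) = 1" "ev s0 (A + q) = 1" "ev s1 A = 1" "ev s2 (A + q + c) = 1"
    and nz: "ev s0 (A + q + c) \<noteq> 0"
  shows "ev s1 (A + p) = 1"
proof -
  have lat: "A \<in> int_lattice" "e \<in> int_lattice" "p \<in> int_lattice" "q \<in> int_lattice" "c \<in> int_lattice"
    "A + p \<in> P" "A + p + e \<in> P" "A + q + c \<in> P" "A + q + c + e \<in> P" "s0 \<in> M_tilde" 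
    using S0 S1 S2 by (auto simp: square_at_def add_ac)
  have v0: "ev s0 A = 0" "fst s0 \<bullet> e = 0" "fst s0 \<bullet> p = 0" "fst s0 \<bullet> q = 1"
    using S0 h(2) by (auto simp: square_at_def ev_add)
  have v2: "ev s2 A = 0" "fst s2 \<bullet> e = 0" "fst s2 \<bullet> q = 0" using S2 by (auto simp: square_at_def)
  have v1: "ev s1 (A + q) = 0" "fst s1 \<bullet> e = 0" "fst s1 \<bullet> c = 0" using S1 by (auto simp: square_at_def)
  let ?B = "A + p" and ?x = "A + q + c"
  have "?x - ?B + A \<in> int_lattice" using lat by (intro int_lattice_intros)
  moreover have "ev s2 (?x - ?B + A) = ev s2 A + (ev s2 ?x - ev s2 ?B)"
    by (simp only: add.commute[of _ A] ev_add[of _ A] ev_diff_ev)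
  then have "ev s2 (?x - ?B + A) = 0" using h v2 by simp
  ultimately obtain i j :: int where "?x - ?B + A = A + of_int i *\<^sub>R e + of_int j *\<^sub>R q"
    using S2 unfolding square_at_def by blast
  then have x: "?x = ?B + of_int i *\<^sub>R e + of_int j *\<^sub>R q" by (simp add: algebra_simps)
  have "ev s0 ?x = of_int j" unfolding x using v0 by (simp add: ev_add)
  moreover have "ev s0 ?x \<ge> 0" using S0 lat by (auto simp: square_at_def)
  ultimately have j1: "j \<ge> 1" using nz by auto
  have "j = 1"
  proof (rule ccontr)
    assume "j \<noteq> 1"
    with j1 have j2: "j \<ge> 2" by simp
    \<comment> \<open>Here \<open>j\<close> is the height of \<open>?x\<close> over the first
      square. Sliding both ends of the segment from \<open>?B\<close> to \<open>?x\<close> by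
      \<alpha> times \<open>e\<close> rounds the \<open>e\<close>-coordinate at parameter
      \<open>1/j\<close> up to the integer \<open>m\<close>.\<close>
    define m where "m = \<lceil>real_of_int i / j\<rceil>"
    define \<alpha> where "\<alpha> = of_int m - real_of_int i / j"
    have \<alpha>: "0 \<le> \<alpha>" "\<alpha> \<le> 1" unfolding \<alpha>_def m_def by linarith+
    have C: "convex P" using E by (rule empty_lattice_polytope_convex)
    have 1: "?B + \<alpha> *\<^sub>R e \<in> P" using convex_shift[OF C _ _ \<alpha>, of ?B e] lat by blast
    have 2: "?x + \<alpha> *\<^sub>R e \<in> P" using convex_shift[OF C _ _ \<alpha>, of ?x e] lat by blast
    have t: "0 < 1 / real_of_int j" "1 / real_of_int j < 1" using j2 by auto
    have "(?x + \<alpha> *\<^sub>R e) - (?B + \<alpha> *\<^sub>R e) = of_int i *\<^sub>R e + of_int j *\<^sub>R q"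
      unfolding x by simp
    then have "?B + \<alpha> *\<^sub>R e + (1 / of_int j) *\<^sub>R ((?x + \<alpha> *\<^sub>R e) - (?B + \<alpha> *\<^sub>R e))
      = ?B + q + (\<alpha> + of_int i / of_int j) *\<^sub>R e"
      using j2 by (simp add: algebra_simps)
    also have "\<dots> = ?B + q + of_int m *\<^sub>R e" by (simp add: \<alpha>_def)
    also have "\<dots> \<in> int_lattice" using lat by (intro int_lattice_intros)
    finally have "?B + \<alpha> *\<^sub>R e = ?x + \<alpha> *\<^sub>R e"
      using empty_lattice_polytope_segment[OF E 1 2 t] by blast
    then have "?B = ?x" by simp
    then have "ev s0 ?x = ev s0 ?B" by (simp only:)
    then show False using nz v0 by (simp add: ev_add)
  qed
  \<comment> \<open>Here \<open>s1\<close> vanishes at \<open>?x\<close> and on \<open>e\<close>,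
    and takes the value -1 on \<open>q\<close>.\<close>
  then have "?x = ?B + of_int i *\<^sub>R e + q" using x by simp
  then have "ev s1 ?x = ev s1 (?B + of_int i *\<^sub>R e + q)" by (simp only:)
  then show ?thesis using v1 h(3) by (simp add: ev_add)
qed

text \<open>The third square meets the two disjoint ones in opposite edges. After alignment
  \<open>s1\<close> equals 1 on the edge shared with the first square and, by
  \<open>square_at_opposite_edge\<close>, also on the opposite edge of the first square; the centre
  lies between.\<close>

lemma square_at_centre_opposite:
  assumes E: "empty_lattice_polytope P" and S0: "square_at P s0 a0 p0 q0"
    and S1: "square_at P s1 a1 p1 q1" and S2: "square_at P s2 a2 p2 q2"
    and disj: "\<And>x. x \<in> P \<Longrightarrow> x \<in> int_lattice \<Longrightarrow> ev s0 x = 0 \<Longrightarrow> ev s1 x \<noteq> 0"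
    and v: "v \<in> P" "v \<in> int_lattice" "ev s0 v = 0" "ev s2 v = 0"
    and neq: "ev s0 z = 0" "ev s2 z \<noteq> 0" "ev s2 z' = 0" "ev s0 z' \<noteq> 0"
    and w: "w \<in> P" "w \<in> int_lattice" "ev s2 w = 0" "ev s1 w = 0"
    and neq': "ev s2 y = 0" "ev s1 y \<noteq> 0" "ev s1 y' = 0" "ev s2 y' \<noteq> 0"
  shows "ev s1 (a0 + (1/2) *\<^sub>R (p0 + q0)) = 1"
proof -
  obtain A e p q where 1: "square_at P s0 A e p" "square_at P s2 A e q"
    "ev s2 (A + p) = 1" "ev s0 (A + q) = 1"
    "A + (1/2) *\<^sub>R (e + p) = a0 + (1/2) *\<^sub>R (p0 + q0)"
    "A + (1/2) *\<^sub>R (e + q) = a2 + (1/2) *\<^sub>R (p2 + q2)"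
    using square_at_adjacent[OF E S0 S2 v neq] .
  obtain B f b c where 2: "square_at P s2 B f b" "square_at P s1 B f c"
    "ev s1 (B + b) = 1" "ev s2 (B + c) = 1"
    "B + (1/2) *\<^sub>R (f + b) = a2 + (1/2) *\<^sub>R (p2 + q2)"
    using square_at_adjacent[OF E S2 S1 w neq'] by metis
  have zero: "ev s0 A = 0" "ev s0 (A + e) = 0" "ev s2 B = 0" "ev s2 (B + f) = 0"
    "ev s1 B = 0" "ev s1 (B + f) = 0" "f \<noteq> 0" "fst s1 \<bullet> f = 0"
    using 1 2 by (auto simp: square_at_def ev_add)
  have lat: "B \<in> P" "B + f \<in> P" "B \<in> int_lattice" "B + f \<in> int_lattice"
    using 2 by (auto simp: square_at_def int_lattice_add)
  have "A + e + q = A + q + e" by simp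
  \<comment> \<open>These endpoints have \<open>s1\<close>-height 0, so disjointness excludes
    \<open>A\<close> and \<open>A + e\<close>, which have \<open>s0\<close>-height 0.\<close>
  then have "B \<in> {A + q, A + q + e}" "B + f \<in> {A + q, A + q + e}"
    using square_at_corner[OF E 1(2), of B] square_at_corner[OF E 1(2), of "B + f"] zero lat disj by auto
  then consider "B = A + q" "f = e" | "B = A + q + e" "f = - e"
    using zero(7) edge_orientation by blast
  then have BF: "square_at P s2 (A + q) e b \<and> square_at P s1 (A + q) e c \<and>
     ev s1 (A + q + b) = 1 \<and> ev s2 (A + q + c) = 1 \<and>
     A + q + (1/2) *\<^sub>R (e + b) = a2 + (1/2) *\<^sub>R (p2 + q2)"
  proof cases
    case 1
    then show ?thesis using 2 by simp
  next
    case c: 2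
    have Bf: "A + q = B + f" "e = - f" using c by simp_all
    have "fst s2 \<bullet> f = 0" using 2 by (auto simp: square_at_def)
    then have "ev s1 (B + f + b) = 1" "ev s2 (B + f + c) = 1"
      using 2 zero by (auto simp: ev_add)
    moreover have "B + f + (1/2) *\<^sub>R (- f + b) = B + (1/2) *\<^sub>R (f + b)"
      using scaleR_left_distrib[of "1/2" "1/2" f] by (simp add: algebra_simps)
    ultimately show ?thesis unfolding Bf using 2 by (simp add: square_at_flip)
  qed
  \<comment> \<open>Both descriptions of the third square have the same centre, which determines
    \<open>b\<close>.\<close>
  then have "A + q + (1/2) *\<^sub>R (e + b) = A + (1/2) *\<^sub>R (e + q)" using 1(6) by simp
  from arg_cong[OF this, of "scaleR 2"] have "q + b = 0"
    by (simp add: scaleR_right_distrib scaleR_2)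
  then have b: "b = - q" by (simp add: minus_unique)
  have A1: "ev s1 A = 1" using BF by (simp add: b)
  have x: "A + q + c \<in> P" "A + q + c \<in> int_lattice" "ev s1 (A + q + c) = 0" "fst s1 \<bullet> e = 0"
    using BF by (auto simp: square_at_def int_lattice_add ev_add)
  have "ev s1 (A + p) = 1"
    using square_at_opposite_edge[OF E 1(1,2) _ 1(3,4) A1] BF disj x by blast
  then have "ev s1 (A + (1/2) *\<^sub>R (e + p)) = 1"
    using A1 x(4) by (simp add: ev_add inner_add_right)
  then show ?thesis by (simp only: 1(5))
qed

subsection \<open>Facet generators of square facets\<close>

text \<open>Divide by the gcd \<open>d\<close> of the coordinates; nested Bezout coefficients supply
  the \<open>y\<close> witnessing primitivity of \<open>u\<close>.\<close>

lemma int_lattice_primitive_part: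
  fixes w :: "real ^ 3"
  assumes "w \<in> int_lattice" "w \<noteq> 0"
  obtains d u y where "d > (0::int)" "u \<in> int_lattice" "y \<in> int_lattice" "w = of_int d *\<^sub>R u" "u \<bullet> y = 1"
proof -
  obtain f where f: "\<And>i. w $ i = of_int (f i)"
    using assms(1) unfolding int_lattice_def Ints_def by (simp add: image_iff) metis
  define g where "g = gcd (f 1) (f 2)"
  define d where "d = gcd g (f 3)"
  obtain r1 r2 where r: "r1 * f 1 + r2 * f 2 = g" using bezout_int unfolding g_def by blast
  obtain t1 t2 where t: "t1 * g + t2 * f 3 = d" using bezout_int unfolding d_def by blast
  have "d \<noteq> 0"
  proof
    assume "d = 0"
    then have "f 1 = 0" "f 2 = 0" "f 3 = 0" by (auto simp: d_def g_def)
    then show False using assms(2) f by (simp add: vec_eq_iff forall_3)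
  qed
  then have d: "d > 0" using gcd_ge_0_int[of g "f 3"] unfolding d_def by linarith
  have dv: "d dvd f i" for i
  proof -
    have "d dvd f 1" "d dvd f 2" "d dvd f 3" unfolding d_def g_def by (auto intro: gcd_dvd1 dvd_trans)
    then show ?thesis using forall_3[of "\<lambda>i. d dvd f i"] by blast
  qed
  define u :: "real ^ 3" where "u = (\<chi> i. of_int (f i div d))"
  define y :: "real ^ 3" where "y = vector [of_int (t1 * r1), of_int (t1 * r2), of_int t2]"
  have ul: "u \<in> int_lattice" by (simp add: u_def int_lattice_def)
  have yl: "y \<in> int_lattice" by (simp add: y_def int_lattice_def forall_3)
  have w: "w = of_int d *\<^sub>R u"
    using dv by (simp add: vec_eq_iff u_def f flip: of_int_mult)
  have "w \<bullet> y = of_int (t1 * (r1 * f 1 + r2 * f 2) + t2 * f 3)"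
    by (simp add: inner_vec_def sum_3 y_def f algebra_simps)
  then have "of_int d * (u \<bullet> y) = of_int d" unfolding r t w by simp
  then have "u \<bullet> y = 1" using d by simp
  then show ?thesis using that d ul yl w by blast
qed

lemma vector_2_eq_iff: "(x :: real ^ 2) = y \<longleftrightarrow> x $ 1 = y $ 1 \<and> x $ 2 = y $ 2"
  by (simp add: vec_eq_iff forall_2)

text \<open>Preimages of the unit square's corners give \<open>a\<close>, \<open>p\<close>,
  \<open>q\<close>; the image of a point under the equivalence is then its coordinate vector in this
  frame.\<close>

lemma lattice_equivalent_unit_square:
  fixes F :: "(real ^ 3) set"
  assumes "lattice_equivalent F unit_square"
  obtains a p q where
    "a \<in> int_lattice" "p \<in> int_lattice" "q \<in> int_lattice"
    "a \<in> F" "a + p \<in> F" "a + q \<in> F" "a + p + q \<in> F"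
    "\<And>x. x \<in> affine hull F \<Longrightarrow> \<exists>\<alpha> \<beta>. x = a + \<alpha> *\<^sub>R p + \<beta> *\<^sub>R q"
    "\<And>x. x \<in> affine hull F \<Longrightarrow> x \<in> int_lattice \<Longrightarrow> \<exists>i j::int. x = a + of_int i *\<^sub>R p + of_int j *\<^sub>R q"
    "\<And>\<alpha> \<beta>. \<alpha> *\<^sub>R p + \<beta> *\<^sub>R q = 0 \<Longrightarrow> \<alpha> = 0 \<and> \<beta> = 0"
proof -
  obtain l c where l: "linear l"
    and bij: "bij_betw (\<lambda>x. l x + c) (affine hull F) (affine hull unit_square)"
    and lat: "(\<lambda>x. l x + c) ` (affine hull F \<inter> int_lattice) = affine hull unit_square \<inter> int_lattice"
    and img: "(\<lambda>x. l x + c) ` F = unit_square"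
    using assms unfolding lattice_equivalent_def Let_def by (elim exE conjE)
  define f where "f = (\<lambda>x. l x + c)"
  have inj: "x = y" if "f x = f y" "x \<in> affine hull F" "y \<in> affine hull F" for x y
    using bij that unfolding bij_betw_def inj_on_def f_def by blast
  have FA: "F \<subseteq> affine hull F" by (rule hull_subset)
  have corner: "\<exists>x. x \<in> F \<and> x \<in> int_lattice \<and> f x = v"
    if v: "v \<in> {vector [0, 0], vector [1, 0], vector [0, 1], vector [1, 1]}" for v
  proof -
    have vu: "v \<in> unit_square" unfolding unit_square_def by (rule hull_inc[OF v])
    have "v \<in> int_lattice" using v by (auto simp: int_lattice_def forall_2)
    then have "v \<in> (\<lambda>x. l x + c) ` (affine hull F \<inter> int_lattice)"
      unfolding lat using hull_inc[OF vu] by blast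
    then obtain x' where x': "x' \<in> affine hull F" "x' \<in> int_lattice" "f x' = v" unfolding f_def by blast
    have "v \<in> (\<lambda>x. l x + c) ` F" unfolding img by (rule vu)
    then obtain x where "x \<in> F" "f x = v" unfolding f_def by blast
    \<comment> \<open>One preimage lies in \<open>F\<close>, the other in the lattice; injectivity
      on the affine hull identifies them.\<close>
    then show ?thesis using inj[of x x'] x' FA by auto
  qed
  obtain a where a: "a \<in> F" "a \<in> int_lattice" "f a = vector [0, 0]" using corner by blast
  obtain b where b: "b \<in> F" "b \<in> int_lattice" "f b = vector [1, 0]" using corner by blast
  obtain e where e: "e \<in> F" "e \<in> int_lattice" "f e = vector [0, 1]" using corner by blast
  obtain g where g: "g \<in> F" "g \<in> int_lattice" "f g = vector [1, 1]" using corner by blast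
  define p q where "p = b - a" and "q = e - a"
  have lp: "l p = vector [1, 0]" and lq: "l q = vector [0, 1]"
    using a b e linear_diff[OF l] by (simp_all add: p_def q_def f_def vector_2_eq_iff)
  have fpq: "f (a + \<alpha> *\<^sub>R p + \<beta> *\<^sub>R q) = vector [\<alpha>, \<beta>]" for \<alpha> \<beta>
  proof -
    have "f (a + \<alpha> *\<^sub>R p + \<beta> *\<^sub>R q) = f a + \<alpha> *\<^sub>R l p + \<beta> *\<^sub>R l q"
      by (simp add: f_def linear_add[OF l] linear_cmul[OF l] algebra_simps)
    then show ?thesis by (simp add: a lp lq vector_2_eq_iff)
  qed
  have mem: "a + \<alpha> *\<^sub>R p + \<beta> *\<^sub>R q \<in> affine hull F" for \<alpha> \<beta>
    unfolding p_def q_def using a b e FA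
    by (intro mem_affine_3_minus affine_affine_hull) auto
  have rep: "x = a + (f x $ 1) *\<^sub>R p + (f x $ 2) *\<^sub>R q" if "x \<in> affine hull F" for x
    by (rule inj[OF _ that mem]) (simp add: fpq vector_2_eq_iff)
  have "g = a + p + q" using rep[of g] g FA by auto
  moreover have "\<exists>i j::int. x = a + of_int i *\<^sub>R p + of_int j *\<^sub>R q"
    if x: "x \<in> affine hull F" "x \<in> int_lattice" for x
  proof -
    have "f x \<in> int_lattice" using lat x unfolding f_def by blast
    then obtain i j where "f x $ 1 = of_int i" "f x $ 2 = of_int j"
      unfolding int_lattice_def by (auto elim!: Ints_cases simp: forall_2)
    then show ?thesis using rep[OF x(1)] by auto
  qed
  moreover have "\<alpha> = 0 \<and> \<beta> = 0" if "\<alpha> *\<^sub>R p + \<beta> *\<^sub>R q = 0" for \<alpha> \<beta>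
    using fpq[of \<alpha> \<beta>] that a(3) by (simp add: add.assoc vector_2_eq_iff)
  moreover have "p \<in> int_lattice" "q \<in> int_lattice"
    unfolding p_def q_def using a b e by (auto intro: int_lattice_diff)
  moreover have "b = a + p" "e = a + q" by (auto simp: p_def q_def)
  ultimately show ?thesis using that[of a p q] a(1,2) b(1) e(1) g(1) rep by blast
qed

lemma ev_ext:
  assumes "\<And>x. ev s x = ev t x" shows "s = t"
proof (rule prod_eqI)
  show "snd s = snd t" using assms[of 0] by (simp add: ev_alt)
  then have "\<forall>x. fst s \<bullet> x = fst t \<bullet> x" using assms by (simp add: ev_alt)
  then show "fst s = fst t" by (simp add: vector_eq_rdot)
qed

lemma dual_cone_cone_over: "s \<in> dual_cone (cone_over P) \<longleftrightarrow> (\<forall>x\<in>P. 0 \<le> ev s x)"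
proof
  assume "s \<in> dual_cone (cone_over P)"
  then show "\<forall>x\<in>P. 0 \<le> ev s x"
    unfolding dual_cone_def cone_over_def ev_def using hull_inc[of _ "P \<times> {1}" convex_cone] by auto
next
  assume *: "\<forall>x\<in>P. 0 \<le> ev s x"
  have "convex_cone {m. s \<bullet> m \<ge> 0}"
    by (rule convex_cone_halfspace_ge)
  moreover have "P \<times> {1} \<subseteq> {m. s \<bullet> m \<ge> 0}" using * by (auto simp: ev_def)
  ultimately have "convex_cone hull (P \<times> {1}) \<subseteq> {m. s \<bullet> m \<ge> 0}" by (intro hull_minimal)
  then show "s \<in> dual_cone (cone_over P)" by (auto simp: dual_cone_def cone_over_def)
qed

text \<open>The facet lies in this plane, and both have dimension 2. The linear part is nonzero
  because a nonzero constant would not vanish on \<open>F\<close>.\<close>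

lemma affine_hull_facet:
  assumes "F facet_of P" "aff_dim P = 3" "s \<noteq> 0" "F \<noteq> {}" and z: "\<And>x. x \<in> F \<Longrightarrow> ev s x = 0"
  shows "affine hull F = {x. ev s x = 0}"
proof -
  obtain x where "x \<in> F" using assms by blast
  then have "fst s \<noteq> 0" using z[of x] assms by (cases s) (auto simp: ev_alt zero_prod_def)
  have H: "{x. ev s x = 0} = {x. fst s \<bullet> x = - snd s}" by (auto simp: ev_alt)
  have "aff_dim F = 2" using assms by (simp add: facet_of_def)
  moreover have "aff_dim {x. ev s x = 0} = 2"
    unfolding H using \<open>fst s \<noteq> 0\<close> by (simp add: aff_dim_hyperplane)
  moreover have "F \<subseteq> {x. ev s x = 0}" using z by blast
  ultimately have "affine hull F = affine hull {x. ev s x = 0}"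
    using aff_dim_eq_full_gen by metis
  also have "\<dots> = {x. ev s x = 0}"
    unfolding H by (rule hull_same) (rule affine_hyperplane)
  finally show ?thesis .
qed

text \<open>Links \<open>facet_generator\<close> to \<open>square_at\<close>: an explicit primitive
  functional is built and shown to be the unique one described.\<close>

lemma square_facet_generator:
  assumes E: "empty_lattice_polytope P" and dim: "aff_dim P = 3" and F: "F \<in> square_facets P"
  obtains a p q where "square_at P (facet_generator P F) a p q"
    "primitive_in M_tilde (facet_generator P F)"
    "affine hull F = {x. ev (facet_generator P F) x = 0}"
    "F = P \<inter> {x. ev (facet_generator P F) x = 0}"
proof -
  have facet: "F facet_of P" and "lattice_equivalent F unit_square"
    using F by (auto simp: square_facets_def)
  then obtain a p q where lat: "a \<in> int_lattice" "p \<in> int_lattice" "q \<in> int_lattice"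
    and inF: "a \<in> F" "a + p \<in> F" "a + q \<in> F" "a + p + q \<in> F"
    and rep: "\<And>x. x \<in> affine hull F \<Longrightarrow> \<exists>\<alpha> \<beta>. x = a + \<alpha> *\<^sub>R p + \<beta> *\<^sub>R q"
    and repi: "\<And>x. x \<in> affine hull F \<Longrightarrow> x \<in> int_lattice \<Longrightarrow>
        \<exists>i j::int. x = a + of_int i *\<^sub>R p + of_int j *\<^sub>R q"
    and ind: "\<And>\<alpha> \<beta>. \<alpha> *\<^sub>R p + \<beta> *\<^sub>R q = 0 \<Longrightarrow> \<alpha> = 0 \<and> \<beta> = 0"
    using lattice_equivalent_unit_square by metis
  have poly: "polytope P" 
    using E by (auto simp: empty_lattice_polytope_def lattice_polytope_def polytope_def)
  then have C: "convex P" and ph: "polyhedron P"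
    by (auto simp: polytope_imp_convex polytope_imp_polyhedron)
  have face: "F face_of P" and "F \<subseteq> P" "F \<noteq> {}" and dF: "aff_dim F = 2"
    using facet facet_of_imp_subset[OF facet] dim by (simp_all add: facet_of_def)
  then have inP: "a \<in> P" "a + p \<in> P" "a + q \<in> P" "a + p + q \<in> P" using inF by auto
  obtain n b where n: "n \<noteq> 0" "P \<subseteq> {x. n \<bullet> x \<le> b}" "F = P \<inter> {x. n \<bullet> x = b}"
    using facet_of_polyhedron[OF ph facet] by blast
  have nb: "n \<bullet> a = b" "n \<bullet> p = 0" "n \<bullet> q = 0"
    using inF n(3) by (auto simp: inner_add_right)
  have pq: "p \<noteq> 0" "q \<noteq> 0" using ind[of 1 0] ind[of 0 1] by auto
  \<comment> \<open>An integral normal of the plane, parallel to the real normal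
    \<open>n\<close>.\<close>
  define u0 where "u0 = cross3 p q"
  have u0l: "u0 \<in> int_lattice"
    using lat unfolding u0_def cross3_def by (auto simp: int_lattice_def forall_3)
  have u0: "u0 \<noteq> 0"
  proof
    assume "u0 = 0"
    then have "collinear {0, p, q}" by (simp add: u0_def cross_eq_0)
    then obtain k where "q = k *\<^sub>R p" using pq collinear_lemma[of p q] by blast
    then show False using ind[of k "-1"] by simp
  qed
  have "cross3 n u0 = 0" using nb by (simp add: u0_def Lagrange)
  then have "collinear {0, n, u0}" by (simp add: cross_eq_0)
  then obtain k where k: "u0 = k *\<^sub>R n" using n(1) u0 collinear_lemma[of n u0] by blast
  \<comment> \<open>The sign is chosen negative because \<open>n\<close> is bounded above on
    \<open>P\<close>.\<close>
  obtain w k where w: "w \<in> int_lattice" "w = k *\<^sub>R n" "k < 0"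
  proof (cases "k < 0")
    case True
    then show ?thesis using that k u0l by blast
  next
    case False
    then have "- k < 0" using k u0 by auto
    then show ?thesis using that[of "- u0" "- k"] k u0l int_lattice_minus by auto
  qed
  then have "w \<noteq> 0" using n(1) by simp
  then obtain d u y where d: "d > (0::int)" and ul: "u \<in> int_lattice" and y: "y \<in> int_lattice"
    and wd: "w = of_int d *\<^sub>R u" and uy: "u \<bullet> y = 1"
    using int_lattice_primitive_part[OF w(1)] by blast
  define \<kappa> where "\<kappa> = k / of_int d"
  have \<kappa>: "\<kappa> < 0" using w(3) d by (simp add: \<kappa>_def divide_neg_pos)
  have ux: "u \<bullet> x = \<kappa> * (n \<bullet> x)" for x
  proof -
    have "of_int d * (u \<bullet> x) = k * (n \<bullet> x)" using wd w(2) by (metis inner_scaleR_left)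
    then show ?thesis using d by (simp add: \<kappa>_def field_simps)
  qed
  define s where "s = (u, - (u \<bullet> a))"
  have ev_s: "ev s x = \<kappa> * (n \<bullet> x - b)" for x
    by (simp add: s_def ev_alt ux nb right_diff_distrib)
  have "u \<bullet> a \<in> \<int>" using ul lat(1) dual_int_lattice[where 'n = 3] by (auto simp: dual_lattice_def)
  then have sM: "s \<in> M_tilde" using ul by (simp add: M_tilde_def s_def dual_int_lattice)
  have ya: "ev s (a + y) = 1" "a + y \<in> int_lattice"
    using uy y lat by (auto simp: s_def ev_alt inner_add_right int_lattice_add)
  have s0: "s \<noteq> 0" using uy by (auto simp: s_def zero_prod_def)
  have sP: "\<forall>x\<in>P. 0 \<le> ev s x" 
    using n(2) \<kappa> by (auto simp: ev_s mult_le_0_iff zero_le_mult_iff)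
  have sF: "ev s x = 0" if "x \<in> F" for x using that n(3) by (auto simp: ev_s)
  have hull: "affine hull F = {x. ev s x = 0}"
    by (rule affine_hull_facet[OF facet dim s0 \<open>F \<noteq> {}\<close> sF])
  have FP: "F = P \<inter> {x. ev s x = 0}"
    unfolding n(3) using \<kappa> by (auto simp: ev_s)
  have prim: "primitive_in M_tilde s"
    unfolding primitive_in_def
  proof (intro conjI allI ballI impI sM s0)
    fix k :: nat and m' assume m': "m' \<in> M_tilde" "s = real k *\<^sub>R m'"
    obtain r where r: "ev m' (a + y) = of_int r" using ev_int[OF m'(1) ya(2)] by (auto elim: Ints_cases)
    have "real k * ev m' (a + y) = 1" using ya m'(2) by (simp add: ev_def)
    then have "real_of_int (int k * r) = 1" by (simp add: r)
    then have "int k * r = 1" by (simp only: of_int_eq_1_iff)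
    then show "k = 1" using zmult_eq_1_iff[of "int k" r] by auto
  qed
  have gen: "facet_generator P F = s"
    unfolding facet_generator_def
  proof (rule the_equality)
    show "primitive_in M_tilde s \<and> s \<in> dual_cone (cone_over P) \<and> (\<forall>v\<in>F. s \<bullet> (v, 1) = 0)"
      using prim sP sF by (simp add: dual_cone_cone_over ev_def)
  next
    fix t assume t: "primitive_in M_tilde t \<and> t \<in> dual_cone (cone_over P) \<and> (\<forall>v\<in>F. t \<bullet> (v, 1) = 0)"
    then have tM: "t \<in> M_tilde" and t0: "t \<noteq> 0" and tP: "\<And>x. x \<in> P \<Longrightarrow> 0 \<le> ev t x"
      and tF: "\<And>x. x \<in> F \<Longrightarrow> ev t x = 0"
      by (auto simp: primitive_in_def dual_cone_cone_over ev_def[symmetric])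
    have hull_t: "affine hull F = {x. ev t x = 0}"
      by (rule affine_hull_facet[OF facet dim t0 \<open>F \<noteq> {}\<close> tF])
    \<comment> \<open>Functionals with the same zero plane are proportional, and their ratio can be
      read off at the lattice point \<open>a + y\<close> of height 1, so it is an integer.\<close>
    define \<mu> where "\<mu> = ev t (a + y)"
    have ta: "ev t a = 0" "ev s a = 0" using tF sF inF by auto
    have tx: "ev t x = \<mu> * ev s x" for x
    proof -
      have "ev s (x - ev s x *\<^sub>R y) = 0" using uy by (simp add: ev_diff) (simp add: s_def)
      then have "ev t (x - ev s x *\<^sub>R y) = 0" using hull hull_t by blast
      then show ?thesis using ta by (simp add: ev_diff \<mu>_def ev_add)
    qed
    then have ts: "t = \<mu> *\<^sub>R s" by (intro ev_ext) (simp add: ev_def)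
    \<comment> \<open>A point of \<open>P\<close> off the plane fixes the sign of the ratio;
      primitivity then makes it 1.\<close>
    have "\<not> P \<subseteq> affine hull F" 
      using aff_dim_subset[of P "affine hull F"] dF dim by auto
    then obtain x where x: "x \<in> P" "ev s x \<noteq> 0" unfolding hull by blast
    then have "ev s x > 0" using sP by force
    then have "\<mu> \<ge> 0" using tP[OF x(1)] unfolding tx by (simp add: zero_le_mult_iff)
    moreover have "\<mu> \<in> \<int>" unfolding \<mu>_def using ev_int[OF tM ya(2)] .
    ultimately have "\<mu> \<in> \<nat>" using Nats_altdef2 by blast
    then obtain k where "\<mu> = real k" by (auto elim: Nats_cases)
    then show "t = s" using t ts sM unfolding primitive_in_def by auto
  qed
  have "fst s \<bullet> p = 0" "fst s \<bullet> q = 0" by (simp_all add: s_def ux nb)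
  moreover have "ev s a = 0" using sF inF by blast
  moreover have "\<forall>x\<in>int_lattice. ev s x = 0 \<longrightarrow> (\<exists>i j::int. x = a + of_int i *\<^sub>R p + of_int j *\<^sub>R q)"
    "\<forall>x. ev s x = 0 \<longrightarrow> (\<exists>i j. x = a + i *\<^sub>R p + j *\<^sub>R q)"
    using rep repi unfolding hull by blast+
  ultimately have "square_at P s a p q"
    unfolding square_at_def using sM lat pq inP sP ya by blast
  then show ?thesis using that[of a p q] prim hull FP gen by simp
qed

section \<open>Distinct facets and the coefficients of the combination\<close>

text \<open>A proper face has smaller dimension. Hence distinct square facets span distinct
  planes.\<close>

lemma square_facets_subset_imp_eq:
  assumes "convex P" "F \<in> square_facets P" "G \<in> square_facets P" "F \<subseteq> G"
  shows "F = G"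
proof (rule ccontr)
  assume "F \<noteq> G"
  have f: "F face_of P" "G face_of P" "aff_dim F = aff_dim G"
    using assms by (auto simp: square_facets_def facet_of_def)
  then have "F face_of G"
    using face_of_subset[OF f(1) assms(4) face_of_imp_subset[OF f(2)]] by simp
  moreover have "convex G" using f face_of_imp_convex by blast
  ultimately have "aff_dim F < aff_dim G" by (rule face_of_aff_dim_lt[OF _ _ \<open>F \<noteq> G\<close>, rotated])
  then show False using f by simp
qed

lemma square_at_corners:
  assumes "square_at P s a p q" "v \<in> {a, a + p, a + q}"
  shows "v \<in> P" "v \<in> int_lattice" "ev s v = 0"
proof -
  have "a \<in> P" "a + p \<in> P" "a + q \<in> P" "a \<in> int_lattice" "p \<in> int_lattice" "q \<in> int_lattice"
    "ev s a = 0" "fst s \<bullet> p = 0" "fst s \<bullet> q = 0"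
    using assms(1) unfolding square_at_def by blast+
  then show "v \<in> P" "v \<in> int_lattice" "ev s v = 0"
    using assms(2) int_lattice_add by (auto simp: ev_add)
qed

text \<open>Comparing affine functions gives \<open>t = m (R_star - s)\<close>, so \<open>m\<close>
  divides a primitive element.\<close>

lemma primitive_combination_unit:
  assumes s: "s \<in> M_tilde" and t: "primitive_in M_tilde t"
    and eq: "\<And>x. real m * (1 - ev s x) + (1 - ev t x) = 1"
  shows "m = 1"
proof -
  have "t = real m *\<^sub>R (R_star - s)"
  proof (rule ev_ext)
    fix x
    have "ev (real m *\<^sub>R (R_star - s)) x = real m * (1 - ev s x)"
      by (simp add: ev_def R_star_def inner_diff_left)
    then show "ev t x = ev (real m *\<^sub>R (R_star - s)) x" using eq[of x] by simp
  qed
  moreover have "R_star - s \<in> M_tilde"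
    using s by (cases s) (auto simp: M_tilde_def R_star_def dual_int_lattice int_lattice_minus)
  ultimately show ?thesis using t unfolding primitive_in_def by blast
qed

theorem lemma5p1:
  fixes P :: "(real ^ 3) set" and n :: "(real ^ 3) set \<Rightarrow> nat"
  assumes "empty_lattice_polytope P"
    and "aff_dim P = 3"
    and "(\<Sum>F\<in>square_facets P. real (n F) *\<^sub>R (R_star - facet_generator P F)) = R_star"
  shows "\<exists>F1\<in>square_facets P. \<exists>F2\<in>square_facets P.
           F1 \<noteq> F2 \<and> n F1 = 1 \<and> n F2 = 1 \<and>
           (\<forall>F\<in>square_facets P - {F1, F2}. n F = 0) \<and>
           affine_parallel (affine hull F1) (affine hull F2)"
proof -
  note E = assms(1)
  have C: "convex P" by (rule empty_lattice_polytope_convex[OF E])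
  have "polytope P"
    using E by (auto simp: empty_lattice_polytope_def lattice_polytope_def polytope_def)
  then have fin: "finite (square_facets P)"
    unfolding square_facets_def by (rule finite_subset[OF _ finite_polytope_facets, rotated]) auto
  define s where "s = facet_generator P"
  have "\<forall>F\<in>square_facets P. \<exists>a p q. square_at P (s F) a p q"
    unfolding s_def using square_facet_generator[OF E assms(2)] by metis
  then obtain a p q where sq: "\<And>F. F \<in> square_facets P \<Longrightarrow> square_at P (s F) (a F) (p F) (q F)"
    by metis
  have prim: "primitive_in M_tilde (s F)" and hull: "affine hull F = {x. ev (s F) x = 0}"
    and FP: "F = P \<inter> {x. ev (s F) x = 0}" if "F \<in> square_facets P" for F
    unfolding s_def using square_facet_generator[OF E assms(2) that] by metis+
  have neq: "\<exists>z. ev (s F) z = 0 \<and> ev (s G) z \<noteq> 0"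
    if "F \<in> square_facets P" "G \<in> square_facets P" "F \<noteq> G" for F G
    using square_facets_subset_imp_eq[OF C that(1,2)] FP that by blast
  define T where "T = {F \<in> square_facets P. n F \<noteq> 0}"
  have finT: "finite T" and TS: "\<And>F. F \<in> T \<Longrightarrow> F \<in> square_facets P" and Tpos: "\<And>F. F \<in> T \<Longrightarrow> 1 \<le> real (n F)"
    using fin by (auto simp: T_def)
  \<comment> \<open>Pair the hypothesis with \<open>(x, 1)\<close>, where \<open>R_star\<close>
    takes the value 1.\<close>
  have eq: "(\<Sum>F\<in>T. real (n F) * (1 - ev (s F) x)) = 1" for x
  proof -
    have "(\<Sum>F\<in>square_facets P. real (n F) *\<^sub>R (R_star - s F)) \<bullet> (x, 1) = R_star \<bullet> (x, 1)"
      using assms(3) by (simp add: s_def)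
    then have "(\<Sum>F\<in>square_facets P. real (n F) * (1 - ev (s F) x)) = 1"
      by (simp add: inner_sum_left inner_diff_left R_star_def ev_def)
    moreover have "(\<Sum>F\<in>T. real (n F) * (1 - ev (s F) x)) = (\<Sum>F\<in>square_facets P. real (n F) * (1 - ev (s F) x))"
      using fin by (intro sum.mono_neutral_left) (auto simp: T_def)
    ultimately show ?thesis by simp
  qed
  define cent where "cent F = a F + (1/2) *\<^sub>R (p F + q F)" for F
  have cent0: "ev (s F) (cent F) = 0" if "F \<in> square_facets P" for F
    using sq[OF that] by (simp add: cent_def ev_add inner_add_right square_at_def)
  define adj where "adj F G \<longleftrightarrow> (\<exists>v\<in>P \<inter> int_lattice. ev (s F) v = 0 \<and> ev (s G) v = 0)" for F G
  have adj_cent: "ev (s G) (cent F) = 1/2"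
    if FG: "F \<in> square_facets P" "G \<in> square_facets P" "F \<noteq> G" "adj F G" for F G
  proof -
    obtain z where "ev (s F) z = 0" "ev (s G) z \<noteq> 0" using neq FG by blast
    moreover obtain z' where "ev (s G) z' = 0" "ev (s F) z' \<noteq> 0" using neq FG by metis
    moreover obtain v where "v \<in> P" "v \<in> int_lattice" "ev (s F) v = 0" "ev (s G) v = 0"
      using FG(4) by (auto simp: adj_def)
    ultimately show ?thesis
      unfolding cent_def using square_at_centre_adjacent[OF E sq[OF FG(1)] sq[OF FG(2)]] by blast
  qed
  have half_pos: "(\<Sum>F\<in>U. real (n F) * (1 - ev (s F) (cent F0))) > 0"
    if "U \<subseteq> T" "U \<noteq> {}" "F0 \<in> T" "\<And>F. F \<in> U \<Longrightarrow> F \<noteq> F0 \<and> adj F0 F" for U F0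
  proof (rule sum_pos)
    show "finite U" using finT that(1) finite_subset by blast
    fix F assume "F \<in> U"
    then have "ev (s F) (cent F0) = 1/2" "1 \<le> real (n F)"
      using that TS Tpos adj_cent[of F0 F] by blast+
    then show "0 < real (n F) * (1 - ev (s F) (cent F0))" by simp
  qed (use that in auto)
  have "\<exists>F0\<in>T. \<exists>F1\<in>T. F0 \<noteq> F1 \<and> \<not> adj F0 F1"
  proof (rule ccontr)
    assume "\<not> ?thesis"
    then have all: "adj F G" if "F \<in> T" "G \<in> T" "F \<noteq> G" for F G using that by blast
    have "T \<noteq> {}" using eq[of 0] by auto
    then obtain F0 where F0: "F0 \<in> T" by blast
    \<comment> \<open>The term of \<open>F0\<close> is already at least 1, and every other term
      would add a positive amount.\<close>
    have "real (n F0) + (\<Sum>F\<in>T - {F0}. real (n F) * (1 - ev (s F) (cent F0))) = 1"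
      using eq[of "cent F0"] cent0[OF TS[OF F0]] by (simp add: sum.remove[OF finT F0])
    moreover have "1 \<le> real (n F0)" using Tpos F0 .
    ultimately have "T - {F0} = {}" 
      using half_pos[of "T - {F0}" F0] all F0 by fastforce
    then have T: "T = {F0}" using F0 by blast
    \<comment> \<open>At height 1 the only remaining term vanishes.\<close>
    obtain y where "ev (s F0) y = 1" using sq[OF TS[OF F0]] by (auto simp: square_at_def)
    then show False using eq[of y] by (simp add: T)
  qed
  then obtain F0 F1 where F01: "F0 \<in> T" "F1 \<in> T" "F0 \<noteq> F1" "\<not> adj F0 F1" by blast
  note S0 = sq[OF TS[OF F01(1)]] and S1 = sq[OF TS[OF F01(2)]]
  have disj: "\<And>x. x \<in> P \<Longrightarrow> x \<in> int_lattice \<Longrightarrow> ev (s F0) x = 0 \<Longrightarrow> ev (s F1) x \<noteq> 0"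
    using F01(4) unfolding adj_def by blast
  then have disj': "\<And>x. x \<in> P \<Longrightarrow> x \<in> int_lattice \<Longrightarrow> ev (s F1) x = 0 \<Longrightarrow> ev (s F0) x \<noteq> 0"
    by blast
  \<comment> \<open>If \<open>F2\<close> missed \<open>F\<close>, all its corners would lie in the
    plane of \<open>G\<close> by \<open>square_at_disjoint_cover\<close>, forcing equal planes.
    Stated for general \<open>F\<close>, \<open>G\<close> so that \<open>F0\<close> and
    \<open>F1\<close> can exchange roles.\<close>
  have meets: "adj F F2"
    if "F2 \<in> T" "F \<in> T" "G \<in> T" "F2 \<noteq> G" and
      d: "\<And>x. x \<in> P \<Longrightarrow> x \<in> int_lattice \<Longrightarrow> ev (s F) x = 0 \<Longrightarrow> ev (s G) x \<noteq> 0" for F2 F G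
  proof (rule ccontr)
    assume n: "\<not> adj F F2"
    note S2 = sq[OF TS[OF that(1)]]
    have "ev (s G) x = 0" if "x \<in> P" "x \<in> int_lattice" "ev (s F2) x = 0" for x
      using square_at_disjoint_cover[OF E sq[OF TS[OF \<open>F \<in> T\<close>]] sq[OF TS[OF \<open>G \<in> T\<close>]] d that(1,2)]
        n that unfolding adj_def by blast
    then have "ev (s G) (a F2) = 0" "ev (s G) (a F2 + p F2) = 0" "ev (s G) (a F2 + q F2) = 0"
      using square_at_corners[OF S2] by simp_all
    then have G: "ev (s G) (a F2) = 0" "fst (s G) \<bullet> p F2 = 0" "fst (s G) \<bullet> q F2 = 0"
      by (simp_all add: ev_add)
    have "ev (s G) z = 0" if z: "ev (s F2) z = 0" for z
    proof -
      obtain i j where "z = a F2 + i *\<^sub>R p F2 + j *\<^sub>R q F2"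
        using S2 z unfolding square_at_def by blast
      then show ?thesis using G by (simp add: ev_add)
    qed
    then show False using neq[OF TS[OF that(1)] TS[OF that(3)] that(4)] by blast
  qed
  have split: "(\<Sum>F\<in>T. f F) = f F0 + (f F1 + (\<Sum>F\<in>T - {F0, F1}. f F))" for f :: "_ \<Rightarrow> real"
  proof -
    have "F1 \<in> T - {F0}" "T - {F0} - {F1} = T - {F0, F1}" using F01 by auto
    then show ?thesis using sum.remove[OF finT F01(1), of f] sum.remove[of "T - {F0}" F1 f] finT by simp
  qed
  have T01: "T - {F0, F1} = {}"
  proof (rule ccontr)
    assume ne: "T - {F0, F1} \<noteq> {}"
    then obtain F2 where F2: "F2 \<in> T" "F2 \<noteq> F0" "F2 \<noteq> F1" by blast
    have m0: "adj F0 F" and m1: "adj F1 F" if "F \<in> T" "F \<noteq> F0" "F \<noteq> F1" for F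
      using meets[of F F0 F1] meets[of F F1 F0] that F01 disj disj' by blast+
    obtain v where v: "v \<in> P" "v \<in> int_lattice" "ev (s F0) v = 0" "ev (s F2) v = 0"
      using m0[OF F2] unfolding adj_def by blast
    obtain w where w: "w \<in> P" "w \<in> int_lattice" "ev (s F2) w = 0" "ev (s F1) w = 0"
      using m1[OF F2] unfolding adj_def by blast
    obtain z1 where z1: "ev (s F0) z1 = 0" "ev (s F2) z1 \<noteq> 0" using neq[of F0 F2] F2 F01 TS by metis
    obtain z2 where z2: "ev (s F2) z2 = 0" "ev (s F0) z2 \<noteq> 0" using neq[of F2 F0] F2 F01 TS by metis
    obtain z3 where z3: "ev (s F2) z3 = 0" "ev (s F1) z3 \<noteq> 0" using neq[of F2 F1] F2 F01 TS by metis
    obtain z4 where z4: "ev (s F1) z4 = 0" "ev (s F2) z4 \<noteq> 0" using neq[of F1 F2] F2 F01 TS by metis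
    have "ev (s F1) (cent F0) = 1"
      unfolding cent_def
      by (rule square_at_centre_opposite[OF E S0 S1 sq[OF TS[OF F2(1)]] disj v z1 z2 w z3 z4])
    \<comment> \<open>The term of \<open>F1\<close> vanishes at this centre.\<close>
    then have "real (n F0) + (\<Sum>F\<in>T - {F0, F1}. real (n F) * (1 - ev (s F) (cent F0))) = 1"
      using eq[of "cent F0"] cent0[OF TS[OF F01(1)]] by (simp add: split)
    moreover have "(\<Sum>F\<in>T - {F0, F1}. real (n F) * (1 - ev (s F) (cent F0))) > 0"
      using ne F01 m0 by (intro half_pos) auto
    ultimately show False using Tpos[OF F01(1)] by linarith
  qed
  then have eq2: "real (n F0) * (1 - ev (s F0) x) + real (n F1) * (1 - ev (s F1) x) = 1" for x
    using eq[of x] by (simp only: split T01 sum.empty add_0_right)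
  have a: "a F0 \<in> P" "a F0 \<in> int_lattice" "ev (s F0) (a F0) = 0"
    "a F1 \<in> P" "a F1 \<in> int_lattice" "ev (s F1) (a F1) = 0" "s F0 \<in> M_tilde" "s F1 \<in> M_tilde"
    using S0 S1 by (auto simp: square_at_def)
  have pos: "n F0 \<ge> 1" "n F1 \<ge> 1" using Tpos F01 by force+
  obtain k l where k: "ev (s F1) (a F0) = real k" and l: "ev (s F0) (a F1) = real l"
    using square_at_height[OF S1 a(1,2)] square_at_height[OF S0 a(4,5)] by metis
  \<comment> \<open>Evaluation at a corner of each facet.\<close>
  have "real (n F0 + n F1) = real (1 + n F1 * k)" "real (n F0 + n F1) = real (1 + n F0 * l)"
    using eq2[of "a F0"] eq2[of "a F1"] k l a by (simp_all add: algebra_simps)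
  then have kl: "n F0 + n F1 = 1 + n F1 * k" "n F0 + n F1 = 1 + n F0 * l"
    by (simp_all only: of_nat_eq_iff)
  have "n F0 = 1 \<or> n F1 = 1"
  proof (rule ccontr)
    assume "\<not> ?thesis"
    then have g: "n F0 \<ge> 2" "n F1 \<ge> 2" using pos by auto
    \<comment> \<open>The value 0 would give coefficient sum 1, and the value 1 would give
      \<open>n F0 = 1\<close>.\<close>
    have "k \<ge> 2" using kl(1) g by (cases k; cases "k - 1") auto
    moreover have "l \<ge> 2" using kl(2) g by (cases l; cases "l - 1") auto
    ultimately have "n F1 * k \<ge> n F1 * 2" "n F0 * l \<ge> n F0 * 2" by simp_all
    then show False using kl g by linarith
  qed
  \<comment> \<open>Whichever coefficient is 1, primitivity of its generator forces the other to be
    1.\<close>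
  then have one: "n F0 = 1" "n F1 = 1"
    using primitive_combination_unit[OF a(7) prim[OF TS[OF F01(2)]], of "n F0"]
      primitive_combination_unit[OF a(8) prim[OF TS[OF F01(1)]], of "n F1"] eq2
    by (auto simp: add.commute)
  \<comment> \<open>The two heights now add up to 1, so the planes are parallel; the translation by
    \<open>a F1 - a F0\<close> carries one to the other.\<close>
  have sum1: "ev (s F1) x = 1 - ev (s F0) x" for x using eq2[of x] by (simp add: one)
  have shift: "ev (s F0) (a F1 - a F0 + x) = 1 + ev (s F0) x" for x
    using sum1[of "a F1"] a by (simp add: ev_alt inner_add_right inner_diff_right)
  have "affine_parallel (affine hull F0) (affine hull F1)"
    unfolding affine_parallel_def hull[OF TS[OF F01(1)]] hull[OF TS[OF F01(2)]]
  proof (intro exI set_eqI iffI)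
    fix x assume "x \<in> {x. ev (s F1) x = 0}"
    then have "ev (s F0) (x - (a F1 - a F0)) = 0"
      using shift[of "x - (a F1 - a F0)"] sum1[of x] by simp
    then show "x \<in> (\<lambda>x. a F1 - a F0 + x) ` {x. ev (s F0) x = 0}"
      by (intro image_eqI[of _ _ "x - (a F1 - a F0)"]) auto
  next
    fix x assume "x \<in> (\<lambda>x. a F1 - a F0 + x) ` {x. ev (s F0) x = 0}"
    then show "x \<in> {x. ev (s F1) x = 0}" using sum1 shift by auto
  qed
  moreover have "n F = 0" if "F \<in> square_facets P - {F0, F1}" for F
    using that T01 by (auto simp: T_def)
  ultimately show ?thesis using F01 TS one by blast
qed

end
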